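(* Let $n,k$ be integers with $2\le k\le n$. Then $$2^{n+1}-k\ \le\ c(n,k)\ \le\ c(k-1,k)+2(2^n-2).$$
   Context: For integers $n\ge1$, $k\ge0$, $c(n,k)$ denotes the least integer such that for every $m$, every matrix $A\in\mathbb{R}^{m\times n}$ and every $b\in\mathbb{R}^m$: if the polyhedron $\{x\in\mathbb{R}^n : Ax\le b\}$ contains exactly $k$ integer points (points of $\mathbb{Z}^n$), then there is a subset $I$ of the rows of $A$ with $|I|\le c(n,k)$ such that $\{x\in\mathbb{R}^n : A_Ix\le b_I\}$ contains exactly the same $k$ integer points, where $A_I,b_I$ are the restrictions to the rows in $I$. *)

theory Defs
  imports Complex_Main "Jordan_Normal_Form.Matrix"
begin

(* The polyhedron of the subsystem A_I x <= b_I; the full system A x <= b is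
   the case I = {..<dim_row A}. *)
definition row_polyhedron :: "real mat \<Rightarrow> real vec \<Rightarrow> nat set \<Rightarrow> real vec set" where
  "row_polyhedron A b I = {x \<in> carrier_vec (dim_col A). \<forall>i\<in>I. (A *\<^sub>v x) $ i \<le> b $ i}"

definition integer_points :: "real vec set \<Rightarrow> real vec set" where
  "integer_points P = {x \<in> P. \<forall>i<dim_vec x. x $ i \<in> \<int>}"

(* No negative integer has this property when n >= 1, since polyhedra with exactly k
   integer points exist; so the least such integer is the least such natural number.
   Finiteness is needed for k = 0, because card is 0 on infinite sets. *)
definition selects_rows :: "nat \<Rightarrow> nat \<Rightarrow> nat \<Rightarrow> bool" where
  "selects_rows n k c \<longleftrightarrow>
     (\<forall>m. \<forall>A \<in> carrier_mat m n. \<forall>b \<in> carrier_vec m.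
        finite (integer_points (row_polyhedron A b {..<m})) \<and>
        card (integer_points (row_polyhedron A b {..<m})) = k \<longrightarrow>
        (\<exists>I\<subseteq>{..<m}. card I \<le> c \<and>
           integer_points (row_polyhedron A b I) = integer_points (row_polyhedron A b {..<m})))"

definition doignon_number :: "nat \<Rightarrow> nat \<Rightarrow> nat" where
  "doignon_number n k = (LEAST c. selects_rows n k c)"

end

theory Submission
  imports Defs
begin

text \<open>
  The problem about inequality systems is first turned into one about finite sets of integer
  points. If no row of a system can be dropped, each row \<open>i\<close> has an integer point violating
  it alone. Raising the right-hand sides one after another as far as no new integer point gets
  strictly inside, one reaches a system in which each row is attained by such a point \<open>v i\<close>,
  while \<open>v i\<close> satisfies all other rows strictly and the solution set \<open>K\<close> all rows. The set \<open>V\<close> of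
  these points and \<open>K\<close> form a \<open>separated_config\<close>: every integer point outside \<open>K\<close>,
  including the members of \<open>V\<close>, can be separated from the rest of \<open>V \<union> K\<close>. Equivalently,
  \<open>V\<close> consists of vertices of the convex hull of \<open>V \<union> K\<close>, and that hull has no further
  integer points; the formulation by separation keeps convex hulls out of the proof. Conversely,
  the separators of a configuration are rows none of which can be dropped when they belong to \<open>V\<close>.
  So \<open>doignon_number n k\<close> is the largest size of \<open>V\<close> over all configurations with
  \<open>k\<close> points in \<open>K\<close> (\<open>card_config_le_doignon_number\<close>, \<open>doignon_number_le\<close>).

  All further arguments rest on one remark (\<open>midpoint_in_core\<close>): if two distinct points of
  \<open>V \<union> K\<close> agree modulo 2, their midpoint is integral, cannot be separated from them, and so
  lies in \<open>K\<close>.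

  Upper bound. The \<open>k\<close> points of \<open>K\<close> lie on the image \<open>H\<close> of an injective affine map
  from the integer points of dimension \<open>k - 1\<close>, and the part of the configuration in \<open>H\<close>
  pulls back to a configuration there; this bounds the number of points of \<open>V\<close> in \<open>H\<close>.
  For points of \<open>V\<close> off \<open>H\<close>, a parity class contains at most two of them: the three midpoints
  of three points would lie in \<open>H\<close>, and then so would the points. A class met by \<open>K\<close> contains none,
  since its midpoint with a point of \<open>K\<close> would lie in \<open>H\<close>, too. Finally \<open>K\<close> meets at
  least two classes, because the midpoint of two congruent points of \<open>K\<close> is a point of
  \<open>K\<close> at half the distance.

  Lower bound. A point of \<open>V\<close> may always be moved to \<open>K\<close>, so each additional point of
  \<open>K\<close> costs at most one point of \<open>V\<close>. It remains to treat \<open>k = 2\<close>, where \<open>V\<close> can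
  have \<open>2 ^ (n + 1) - 2\<close> points (\<open>config_prism\<close>).
\<close>

section \<open>Integer points of polyhedra\<close>

text \<open>Integer points are functions vanishing from \<open>n\<close> on, so that addition and halving
  need no dimension bookkeeping and equality is pointwise.\<close>
definition int_lattice :: "nat \<Rightarrow> (nat \<Rightarrow> int) set" where
  "int_lattice n = {x. \<forall>i\<ge>n. x i = 0}"

definition lin :: "nat \<Rightarrow> (nat \<Rightarrow> real) \<Rightarrow> (nat \<Rightarrow> int) \<Rightarrow> real" where
  "lin n a x = (\<Sum>i<n. a i * of_int (x i))"

definition solutions :: "nat \<Rightarrow> (nat \<Rightarrow> nat \<Rightarrow> real) \<Rightarrow> (nat \<Rightarrow> real) \<Rightarrow> nat set \<Rightarrow> (nat \<Rightarrow> int) set" where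
  "solutions n a b I = {x \<in> int_lattice n. \<forall>i\<in>I. lin n (a i) x \<le> b i}"

definition real_vec_of :: "nat \<Rightarrow> (nat \<Rightarrow> int) \<Rightarrow> real vec" where
  "real_vec_of n x = vec n (\<lambda>i. of_int (x i))"

lemma inj_on_real_vec_of: "inj_on (real_vec_of n) (int_lattice n)"
proof (rule inj_onI, rule ext)
  fix x y i assume xy: "x \<in> int_lattice n" "y \<in> int_lattice n" "real_vec_of n x = real_vec_of n y"
  show "x i = y i"
  proof (cases "i < n")
    case True
    have "real_vec_of n x $ i = real_vec_of n y $ i" using xy by simp
    thus ?thesis using True by (simp add: real_vec_of_def)
  next
    case False thus ?thesis using xy by (simp add: int_lattice_def)
  qed
qed

lemma integer_points_row_polyhedron:
  assumes A: "A \<in> carrier_mat m n" and I: "I \<subseteq> {..<m}"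
  shows "integer_points (row_polyhedron A b I)
    = real_vec_of n ` solutions n (\<lambda>i j. A $$ (i, j)) (\<lambda>i. b $ i) I"
proof -
  have mult: "(A *\<^sub>v real_vec_of n x) $ i = lin n (\<lambda>j. A $$ (i, j)) x" if "i < m" for x i
    using that A by (auto simp: real_vec_of_def lin_def scalar_prod_def atLeast0LessThan intro!: sum.cong)
  have "y \<in> real_vec_of n ` solutions n (\<lambda>i j. A $$ (i, j)) (\<lambda>i. b $ i) I"
    if y: "y \<in> integer_points (row_polyhedron A b I)" for y
  proof -
    define x where "x = (\<lambda>i. if i < n then \<lfloor>y $ i\<rfloor> else 0)"
    have dim: "dim_vec y = n" using y A by (auto simp: integer_points_def row_polyhedron_def)
    have "y = real_vec_of n x"
      using y dim by (intro eq_vecI) (auto simp: real_vec_of_def x_def integer_points_def elim!: Ints_cases)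
    moreover have "lin n (\<lambda>j. A $$ (i, j)) x \<le> b $ i" if "i \<in> I" for i
    proof -
      have "i < m" using I that by auto
      thus ?thesis using y mult[of i x] that \<open>y = real_vec_of n x\<close>
        by (auto simp: integer_points_def row_polyhedron_def)
    qed
    moreover have "x \<in> int_lattice n" by (simp add: int_lattice_def x_def)
    ultimately show ?thesis by (auto simp: solutions_def)
  qed
  moreover have "real_vec_of n x \<in> integer_points (row_polyhedron A b I)"
    if x: "x \<in> solutions n (\<lambda>i j. A $$ (i, j)) (\<lambda>i. b $ i) I" for x
  proof -
    have "real_vec_of n x \<in> carrier_vec (dim_col A)" using A by (simp add: real_vec_of_def)
    moreover have "(A *\<^sub>v real_vec_of n x) $ i \<le> b $ i" if "i \<in> I" for i
      using mult[of i x] that I x by (auto simp: solutions_def)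
    ultimately show ?thesis
      by (auto simp: integer_points_def row_polyhedron_def real_vec_of_def)
  qed
  ultimately show ?thesis by blast
qed

lemma solutions_subset_lattice: "solutions n a b I \<subseteq> int_lattice n"
  by (auto simp: solutions_def)

lemma solutions_cong:
  assumes "\<And>i j. i \<in> I \<Longrightarrow> j < n \<Longrightarrow> a i j = a' i j" and "\<And>i. i \<in> I \<Longrightarrow> b i = b' i"
  shows "solutions n a b I = solutions n a' b' I"
proof -
  have "lin n (a i) x = lin n (a' i) x" if "i \<in> I" for i x
    using assms(1)[OF that] by (simp add: lin_def)
  thus ?thesis using assms(2) by (auto simp: solutions_def)
qed

lemma selects_rows_iff:
  "selects_rows n k c \<longleftrightarrow>
    (\<forall>m a b. finite (solutions n a b {..<m}) \<and> card (solutions n a b {..<m}) = k \<longrightarrow>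
      (\<exists>I\<subseteq>{..<m}. card I \<le> c \<and> solutions n a b I = solutions n a b {..<m}))"
  (is "_ \<longleftrightarrow> ?R")
proof
  assume sel: "selects_rows n k c"
  show ?R
  proof (intro allI impI)
    fix m a b assume fin: "finite (solutions n a b {..<m}) \<and> card (solutions n a b {..<m}) = k"
    define A where "A = mat m n (\<lambda>(i, j). a i j)"
    define b' where "b' = vec m b"
    have eq: "integer_points (row_polyhedron A b' I) = real_vec_of n ` solutions n a b I"
      if "I \<subseteq> {..<m}" for I
    proof -
      have "solutions n (\<lambda>i j. A $$ (i, j)) (\<lambda>i. b' $ i) I = solutions n a b I"
        using that by (intro solutions_cong) (auto simp: A_def b'_def)
      thus ?thesis using integer_points_row_polyhedron[of A m n I b'] that by (simp add: A_def)
    qed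
    have "A \<in> carrier_mat m n" "b' \<in> carrier_vec m" by (auto simp: A_def b'_def)
    moreover have "finite (integer_points (row_polyhedron A b' {..<m}))"
      "card (integer_points (row_polyhedron A b' {..<m})) = k"
      using fin card_image[OF inj_on_subset[OF inj_on_real_vec_of solutions_subset_lattice]]
      by (auto simp: eq)
    ultimately obtain I where I: "I \<subseteq> {..<m}" "card I \<le> c"
      "integer_points (row_polyhedron A b' I) = integer_points (row_polyhedron A b' {..<m})"
      using sel unfolding selects_rows_def by blast
    hence "solutions n a b I = solutions n a b {..<m}"
      using inj_on_image_eq_iff[OF inj_on_real_vec_of solutions_subset_lattice solutions_subset_lattice]
      by (simp add: eq)
    thus "\<exists>I\<subseteq>{..<m}. card I \<le> c \<and> solutions n a b I = solutions n a b {..<m}"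
      using I by blast
  qed
next
  assume R: ?R
  show "selects_rows n k c"
    unfolding selects_rows_def
  proof (intro allI ballI impI)
    fix m A b
    assume A: "A \<in> carrier_mat m n" and "b \<in> carrier_vec m"
      and fin: "finite (integer_points (row_polyhedron A b {..<m})) \<and>
        card (integer_points (row_polyhedron A b {..<m})) = k"
    let ?a = "\<lambda>i j. A $$ (i, j)" and ?b = "\<lambda>i. b $ i"
    have inj: "inj_on (real_vec_of n) (solutions n ?a ?b {..<m})"
      using inj_on_subset[OF inj_on_real_vec_of solutions_subset_lattice] .
    have "finite (solutions n ?a ?b {..<m}) \<and> card (solutions n ?a ?b {..<m}) = k"
      using fin card_image[OF inj] finite_imageD[OF _ inj]
      by (simp add: integer_points_row_polyhedron[OF A])
    then obtain I where "I \<subseteq> {..<m}" "card I \<le> c" "solutions n ?a ?b I = solutions n ?a ?b {..<m}"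
      using R by metis
    thus "\<exists>I\<subseteq>{..<m}. card I \<le> c \<and>
        integer_points (row_polyhedron A b I) = integer_points (row_polyhedron A b {..<m})"
      by (intro exI[of _ I]) (simp add: integer_points_row_polyhedron[OF A])
  qed
qed

section \<open>Boxes and linear functionals\<close>

definition box :: "nat \<Rightarrow> int \<Rightarrow> (nat \<Rightarrow> int) set" where
  "box n B = {x \<in> int_lattice n. \<forall>i<n. \<bar>x i\<bar> \<le> B}"

lemma finite_box: "finite (box n B)"
proof -
  have "box n B \<subseteq> {x. \<forall>i. (i \<in> {..<n} \<longrightarrow> x i \<in> {-B..B}) \<and> (i \<notin> {..<n} \<longrightarrow> x i = 0)}"
    by (auto simp: box_def int_lattice_def abs_le_iff)
  thus ?thesis by (rule finite_subset) (rule finite_set_of_finite_funs; simp)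
qed

lemma finite_subset_box:
  assumes "finite S" "S \<subseteq> int_lattice n"
  obtains B where "S \<subseteq> box n B"
proof
  show "S \<subseteq> box n (\<Sum>x\<in>S. \<Sum>i<n. \<bar>x i\<bar>)"
  proof
    fix x assume x: "x \<in> S"
    have "\<bar>x i\<bar> \<le> (\<Sum>x\<in>S. \<Sum>i<n. \<bar>x i\<bar>)" if "i < n" for i
    proof -
      have "\<bar>x i\<bar> \<le> (\<Sum>i<n. \<bar>x i\<bar>)" using that by (intro member_le_sum) auto
      also have "\<dots> \<le> (\<Sum>x\<in>S. \<Sum>i<n. \<bar>x i\<bar>)"
        using x assms(1) by (intro member_le_sum[of x S "\<lambda>x. \<Sum>i<n. \<bar>x i\<bar>"]) (auto simp: sum_nonneg)
      finally show ?thesis .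
    qed
    thus "x \<in> box n (\<Sum>x\<in>S. \<Sum>i<n. \<bar>x i\<bar>)" using x assms(2) by (auto simp: box_def)
  qed
qed

definition coord :: "nat \<Rightarrow> real \<Rightarrow> nat \<Rightarrow> real" where
  "coord i s = (\<lambda>j. if j = i then s else 0)"

lemma lin_coord: "i < n \<Longrightarrow> lin n (coord i s) x = s * of_int (x i)"
  by (simp add: lin_def coord_def if_distrib[of "\<lambda>t. t * _"] cong: if_cong)

lemma lin_add_left: "lin n (\<lambda>i. a i + b i) x = lin n a x + lin n b x"
  by (simp add: lin_def sum.distrib algebra_simps)

lemma lin_scale_left: "lin n (\<lambda>i. c * a i) x = c * lin n a x"
  by (simp add: lin_def sum_distrib_left algebra_simps)

lemma separates_from_box:
  assumes "p \<in> int_lattice n" "p \<notin> box n B"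
  obtains i s where "i < n" "s = 1 \<or> s = -1" "lin n (coord i s) p > of_int B"
    "\<And>q. q \<in> box n B \<Longrightarrow> lin n (coord i s) q \<le> of_int B"
proof -
  obtain i where i: "i < n" "\<bar>p i\<bar> > B" using assms by (auto simp: box_def not_le)
  define s :: real where "s = (if p i > 0 then 1 else -1)"
  show thesis
  proof (rule that[of i s])
    show "lin n (coord i s) p > of_int B" using i by (auto simp: lin_coord s_def split: if_splits)
    show "lin n (coord i s) q \<le> of_int B" if "q \<in> box n B" for q
    proof -
      have "\<bar>q i\<bar> \<le> B" using that i by (auto simp: box_def)
      thus ?thesis using i by (auto simp: lin_coord s_def)
    qed
  qed (use i in \<open>auto simp: s_def\<close>)
qed

section \<open>Separated configurations and inequality systems\<close>

text \<open>The points of \<open>V\<close> are vertices of the convex hull of \<open>V \<union> K\<close>, and this hull contains no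
  integer points outside \<open>V \<union> K\<close>. Strict separation expresses both at once.\<close>
definition separated_config :: "nat \<Rightarrow> (nat \<Rightarrow> int) set \<Rightarrow> (nat \<Rightarrow> int) set \<Rightarrow> bool" where
  "separated_config n V K \<longleftrightarrow> finite V \<and> finite K \<and> V \<subseteq> int_lattice n \<and> K \<subseteq> int_lattice n \<and> V \<inter> K = {} \<and>
    (\<forall>p\<in>int_lattice n - K. \<exists>a. \<forall>q\<in>V \<union> K - {p}. lin n a q < lin n a p)"

lemma configD:
  assumes "separated_config n V K"
  shows "finite V" "finite K" "V \<subseteq> int_lattice n" "K \<subseteq> int_lattice n" "V \<inter> K = {}"
    and "\<And>p. p \<in> int_lattice n \<Longrightarrow> p \<notin> K \<Longrightarrow> \<exists>a. \<forall>q\<in>V \<union> K - {p}. lin n a q < lin n a p"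
  using assms by (auto simp: separated_config_def)

text \<open>Cut out \<open>K\<close> by a box and, for each of the finitely many integer points \<open>p\<close> of
  the box outside \<open>K\<close>, by a separating inequality. The inequality for \<open>p\<close> is
  satisfied by \<open>V \<union> K\<close> except possibly by \<open>p\<close> itself, so the only row that excludes
  \<open>v \<in> V\<close> is the one made for \<open>v\<close>, and every subsystem with the same integer points keeps it.\<close>
lemma card_config_le_if_selects_rows:
  assumes sel: "selects_rows n k c" and cfg: "separated_config n V K" and k: "card K = k"
  shows "card V \<le> c"
proof -
  note C = configD[OF cfg]
  obtain B where B: "V \<union> K \<subseteq> box n B" using finite_subset_box[of "V \<union> K" n] C by auto
  have "\<exists>a b. b < lin n a p \<and> (\<forall>q\<in>V \<union> K - {p}. lin n a q \<le> b)"
    if p: "p \<in> int_lattice n" "p \<notin> K" for p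
  proof -
    obtain a where a: "\<forall>q\<in>V \<union> K - {p}. lin n a q < lin n a p" using C(6)[OF p] by blast
    have fin: "finite (insert (lin n a p - 1) (lin n a ` (V \<union> K - {p})))" using C by auto
    let ?b = "Max (insert (lin n a p - 1) (lin n a ` (V \<union> K - {p})))"
    have "?b < lin n a p" using fin a by (subst Max_less_iff) auto
    moreover have "\<forall>q\<in>V \<union> K - {p}. lin n a q \<le> ?b" using fin by (auto intro: Max_ge)
    ultimately show ?thesis by blast
  qed
  then obtain \<alpha> \<beta> where sep: "\<And>p. p \<in> int_lattice n \<Longrightarrow> p \<notin> K \<Longrightarrow>
      \<beta> p < lin n (\<alpha> p) p \<and> (\<forall>q\<in>V \<union> K - {p}. lin n (\<alpha> p) q \<le> \<beta> p)"
    by metis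
  define R where "R = (\<lambda>p. (\<alpha> p, \<beta> p)) ` (box n B - K) \<union>
    (\<lambda>(i, s). (coord i s, real_of_int B)) ` ({..<n} \<times> {1, -1})"
  have "finite R" unfolding R_def using finite_box by auto
  then obtain rs where rs: "set rs = R" using finite_list by blast
  let ?a = "\<lambda>i. fst (rs ! i)" and ?b = "\<lambda>i. snd (rs ! i)" and ?m = "length rs"
  have box_lattice: "box n B \<subseteq> int_lattice n" by (auto simp: box_def)
  have coord_ok: "lin n (coord i s) q \<le> B" if "q \<in> box n B" "i < n" "s = 1 \<or> s = -1" for q i s
  proof -
    have "\<bar>q i\<bar> \<le> B" using that by (auto simp: box_def)
    thus ?thesis using that by (auto simp: lin_coord)
  qed
  have violated: "\<exists>p\<in>box n B - K. (a, b) = (\<alpha> p, \<beta> p) \<and> q = p"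
    if ab: "(a, b) \<in> R" and q: "q \<in> V \<union> K" "\<not> lin n a q \<le> b" for a b q
  proof -
    consider p where "p \<in> box n B - K" "a = \<alpha> p" "b = \<beta> p"
      | i s where "i < n" "s = 1 \<or> s = -1" "a = coord i s" "b = real_of_int B"
      using ab unfolding R_def by auto
    thus ?thesis
    proof cases
      case 1
      hence "\<not> (q \<in> V \<union> K - {p})" using sep[of p] box_lattice q(2) by blast
      thus ?thesis using 1 q(1) by blast
    next
      case 2
      thus ?thesis using coord_ok[of q i s] q B by blast
    qed
  qed
  have sol: "solutions n ?a ?b {..<?m} = {x \<in> int_lattice n. \<forall>(a, b)\<in>R. lin n a x \<le> b}"
    unfolding solutions_def rs[symmetric]
    by (auto simp: all_set_conv_all_nth case_prod_unfold)
  have solK: "solutions n ?a ?b {..<?m} = K"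
  proof -
    have "x \<in> K" if x: "x \<in> int_lattice n" and sat: "\<forall>(a, b)\<in>R. lin n a x \<le> b" for x
    proof (rule ccontr)
      assume xK: "x \<notin> K"
      show False
      proof (cases "x \<in> box n B")
        case True
        hence "(\<alpha> x, \<beta> x) \<in> R" using xK by (auto simp: R_def)
        thus False using sat sep[OF x xK] by force
      next
        case False
        then obtain i s where "i < n" "s = 1 \<or> s = -1" "lin n (coord i s) x > of_int B"
          using separates_from_box[OF x] by metis
        moreover from this have "(coord i s, real_of_int B) \<in> R" unfolding R_def by force
        ultimately show False using sat by force
      qed
    qed
    moreover have "lin n a x \<le> b" if "x \<in> K" "(a, b) \<in> R" for x a b
      using violated[OF that(2), of x] that by blast
    ultimately show ?thesis unfolding sol using C(4) by blast
  qed
  obtain I where I: "I \<subseteq> {..<?m}" "card I \<le> c" "solutions n ?a ?b I = K"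
    using sel[unfolded selects_rows_iff, rule_format, of ?a ?b ?m] solK C(2) k by auto
  have "\<exists>i\<in>I. \<not> lin n (?a i) v \<le> ?b i" if "v \<in> V" for v
    using that I(3) C(3,5) unfolding solutions_def by blast
  then obtain r where r: "\<And>v. v \<in> V \<Longrightarrow> r v \<in> I \<and> \<not> lin n (?a (r v)) v \<le> ?b (r v)"
    by metis
  have "inj_on r V"
  proof (rule inj_onI)
    fix u v assume uv: "u \<in> V" "v \<in> V" "r u = r v"
    have "(?a (r u), ?b (r u)) \<in> R" using r[OF uv(1)] I(1) rs by auto
    then obtain p where p: "p \<in> box n B - K" "?a (r u) = \<alpha> p" "?b (r u) = \<beta> p" "u = p"
      using violated[of "?a (r u)" "?b (r u)" u] r[OF uv(1)] uv by auto
    have "\<not> lin n (\<alpha> p) v \<le> \<beta> p" using r[OF uv(2)] uv(3) p by simp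
    hence "v = p" using sep[of p] p(1) uv box_lattice by auto
    thus "u = v" using p by simp
  qed
  hence "card V \<le> card I" using r I(1) by (intro card_inj_on_le) (auto intro: finite_subset)
  thus ?thesis using I(2) by simp
qed

text \<open>The rows are relaxed one at a time. The new threshold of row \<open>i\<close> is the least value that
  \<open>f i\<close> takes on points of \<open>X\<close> violating row \<open>i\<close> alone in the current system, so with a strict inequality no point of \<open>X\<close>
  is gained. Restricting to a finite set \<open>X\<close> makes the minimum exist: over all integer
  points it may fail to, for irrational coefficients.\<close>
lemma tighten_thresholds:
  fixes f :: "'i \<Rightarrow> 'x \<Rightarrow> real"
  assumes "finite I" "finite X"
    and wit: "\<And>i. i \<in> I \<Longrightarrow> \<exists>x\<in>X. b i < f i x \<and> (\<forall>j\<in>I - {i}. f j x \<le> b j)"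
  obtains v where "\<And>i. i \<in> I \<Longrightarrow> v i \<in> X" and "\<And>i. i \<in> I \<Longrightarrow> b i < f i (v i)"
    and "\<And>i j. i \<in> I \<Longrightarrow> j \<in> I \<Longrightarrow> i \<noteq> j \<Longrightarrow> f j (v i) < f j (v j)"
    and "\<And>x. x \<in> X \<Longrightarrow> (\<And>i. i \<in> I \<Longrightarrow> f i x < f i (v i)) \<Longrightarrow> (\<forall>i\<in>I. f i x \<le> b i)"
proof -
  (* S is the set of rows already relaxed to a strict inequality; the others are still as given. *)
  have "\<exists>v. (\<forall>i\<in>S. v i \<in> X \<and> b i < f i (v i) \<and> (\<forall>j\<in>S - {i}. f j (v i) < f j (v j)) \<and>
        (\<forall>j\<in>I - S. f j (v i) \<le> b j)) \<and>
      (\<forall>x\<in>X. (\<forall>i\<in>S. f i x < f i (v i)) \<and> (\<forall>j\<in>I - S. f j x \<le> b j) \<longrightarrow> (\<forall>i\<in>I. f i x \<le> b i))"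
    if "finite S" "S \<subseteq> I" for S
    using that
  proof (induction S rule: finite_induct)
    case empty
    show ?case by simp
  next
    case (insert i S)
    then obtain v where
      A: "\<And>j. j \<in> S \<Longrightarrow> v j \<in> X \<and> b j < f j (v j) \<and> (\<forall>l\<in>S - {j}. f l (v j) < f l (v l)) \<and>
        (\<forall>l\<in>I - S. f l (v j) \<le> b l)"
      and B: "\<And>x. x \<in> X \<Longrightarrow> (\<forall>i\<in>S. f i x < f i (v i)) \<and> (\<forall>j\<in>I - S. f j x \<le> b j) \<Longrightarrow>
        (\<forall>i\<in>I. f i x \<le> b i)"
      by (metis insert_subset)
    have v: "\<And>j. j \<in> S \<Longrightarrow> v j \<in> X" "\<And>j. j \<in> S \<Longrightarrow> b j < f j (v j)"
      "\<And>j l. j \<in> S \<Longrightarrow> l \<in> S \<Longrightarrow> l \<noteq> j \<Longrightarrow> f l (v j) < f l (v l)"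
      "\<And>j l. j \<in> S \<Longrightarrow> l \<in> I \<Longrightarrow> l \<notin> S \<Longrightarrow> f l (v j) \<le> b l"
      "\<And>x. x \<in> X \<Longrightarrow> (\<forall>i\<in>S. f i x < f i (v i)) \<Longrightarrow> (\<forall>j\<in>I - S. f j x \<le> b j) \<Longrightarrow> (\<forall>i\<in>I. f i x \<le> b i)"
      using A B by simp_all
    define M where "M = {x \<in> X. b i < f i x \<and> (\<forall>j\<in>S. f j x < f j (v j)) \<and>
      (\<forall>j\<in>I - insert i S. f j x \<le> b j)}"
    have iI: "i \<in> I" "i \<notin> S" using insert by auto
    obtain x where x: "x \<in> X" "b i < f i x" "\<forall>j\<in>I - {i}. f j x \<le> b j" using wit[OF iI(1)] by blast
    have "f j x < f j (v j)" if "j \<in> S" for j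
    proof -
      have "f j x \<le> b j" using x(3) that insert.prems iI by auto
      thus ?thesis using v(2)[OF that] by simp
    qed
    hence "x \<in> M" using x by (auto simp: M_def)
    moreover have "finite M" using \<open>finite X\<close> by (simp add: M_def)
    ultimately obtain y where y: "y \<in> M" "\<And>z. z \<in> M \<Longrightarrow> f i y \<le> f i z"
      using ex_is_arg_min_if_finite[of M "f i"] by (auto simp: is_arg_min_linorder)
    show ?case
    proof (intro exI[of _ "v(i := y)"] conjI ballI impI)
      fix x l assume x: "x \<in> X" "(\<forall>j\<in>insert i S. f j x < f j ((v(i := y)) j)) \<and>
        (\<forall>j\<in>I - insert i S. f j x \<le> b j)" and l: "l \<in> I"
      have S: "\<forall>j\<in>S. f j x < f j (v j)"
        using x(2) iI by (metis fun_upd_other insertCI)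
      have "f i x \<le> b i"
      proof (rule ccontr)
        assume "\<not> f i x \<le> b i"
        hence "x \<in> M" using x S by (auto simp: M_def)
        thus False using y(2)[of x] x(2) by auto
      qed
      thus "f l x \<le> b l" using v(5)[OF x(1) S] x(2) l by blast
    next
      fix j l assume j: "j \<in> insert i S" and l: "l \<in> insert i S - {j}"
      show "f l ((v(i := y)) j) < f l ((v(i := y)) l)"
      proof (cases "j = i")
        case True
        thus ?thesis using y(1) l by (auto simp: M_def)
      next
        case False
        hence jS: "j \<in> S" using j by simp
        show ?thesis
        proof (cases "l = i")
          case True
          have "f i (v j) \<le> b i" using v(4)[OF jS iI] .
          also have "b i < f i y" using y(1) by (simp add: M_def)
          finally show ?thesis using True False by simp
        next
          case l: False
          thus ?thesis using v(3)[OF jS, of l] \<open>l \<in> insert i S - {j}\<close> False by auto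
        qed
      qed
    qed (use y(1) v(1,2,4) in \<open>auto simp: M_def\<close>)
  qed
  from this[of I] obtain v where "\<forall>i\<in>I. v i \<in> X \<and> b i < f i (v i) \<and> (\<forall>j\<in>I - {i}. f j (v i) < f j (v j))"
    "\<forall>x\<in>X. (\<forall>i\<in>I. f i x < f i (v i)) \<longrightarrow> (\<forall>i\<in>I. f i x \<le> b i)"
    using \<open>finite I\<close> by auto
  thus thesis by (intro that[of v]) auto
qed

text \<open>If the functional \<open>a\<close> puts \<open>p\<close> above all of \<open>Q\<close> except for a tie with one point
  \<open>u\<close>, adding a small multiple of the direction \<open>p - u\<close> breaks the tie. Instead of a
  small multiple, \<open>a\<close> is scaled by a large \<open>N\<close>.\<close>
lemma separate_tied_point:
  assumes "finite Q" "p \<in> int_lattice n" "u \<in> int_lattice n" "p \<noteq> u"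
    and less: "\<And>q. q \<in> Q \<Longrightarrow> q \<noteq> u \<Longrightarrow> lin n a q < lin n a p" and "lin n a u \<le> lin n a p"
  obtains a' where "\<And>q. q \<in> insert u Q \<Longrightarrow> lin n a' q < lin n a' p"
proof -
  define g where "g = lin n (\<lambda>i. of_int (p i - u i))"
  define r where "r q = \<bar>(g q - g p) / (lin n a p - lin n a q)\<bar>" for q
  define N where "N = 1 + (\<Sum>q\<in>Q. r q)"
  have N: "N \<ge> 1" by (simp add: N_def r_def sum_nonneg)
  have diff: "g p - g u = (\<Sum>i<n. (of_int (p i - u i))\<^sup>2)"
    unfolding g_def lin_def sum_subtractf[symmetric]
    by (intro sum.cong) (auto simp: algebra_simps power2_eq_square)
  have "\<exists>i<n. p i \<noteq> u i"
  proof (rule ccontr)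
    assume "\<not> (\<exists>i<n. p i \<noteq> u i)"
    hence "p i = u i" for i using assms(2,3) by (cases "i < n") (auto simp: int_lattice_def)
    hence "p = u" by auto
    thus False using assms(4) by simp
  qed
  then obtain i where "i < n" "p i \<noteq> u i" by blast
  hence "(\<Sum>i<n. (real_of_int (p i - u i))\<^sup>2) > 0" by (intro sum_pos2[of _ i]) auto
  hence gu: "g u < g p" using diff by linarith
  define a' where "a' = (\<lambda>i. N * a i + of_int (p i - u i))"
  have a': "lin n a' q = N * lin n a q + g q" for q
    unfolding a'_def g_def by (simp only: lin_add_left lin_scale_left)
  show thesis
  proof (rule that[of a'])
    fix q assume q: "q \<in> insert u Q"
    show "lin n a' q < lin n a' p"
    proof (cases "q = u")
      case True
      have "N * lin n a u \<le> N * lin n a p" using assms(6) N by (intro mult_left_mono) auto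
      thus ?thesis using gu True by (simp add: a')
    next
      case False
      hence qQ: "q \<in> Q" and pos: "lin n a p - lin n a q > 0" using q less by auto
      have "r q \<le> (\<Sum>q\<in>Q. r q)" using qQ assms(1) by (intro member_le_sum) (auto simp: r_def)
      hence "(g q - g p) / (lin n a p - lin n a q) < N" unfolding N_def r_def by linarith
      hence "g q - g p < N * (lin n a p - lin n a q)" using pos by (simp add: divide_less_eq)
      thus ?thesis by (simp add: a' algebra_simps)
    qed
  qed
qed

text \<open>In a smallest subsystem \<open>I\<close> with the same integer points each row has a point violating it
  alone. Tightening inside a box that contains these points and \<open>K\<close> yields a configuration
  with one vertex for each row of \<open>I\<close>. An integer point of the box outside \<open>K\<close> reaches the
  threshold of some row and is separated by it, up to a tie with the vertex of that row; points
  outside the box are separated by a coordinate.\<close>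
lemma selects_rows_if_card_config_le:
  assumes bound: "\<And>V K. separated_config n V K \<Longrightarrow> card K = k \<Longrightarrow> card V \<le> c"
  shows "selects_rows n k c"
  unfolding selects_rows_iff
proof (intro allI impI)
  fix m a b
  define K where "K = solutions n a b {..<m}"
  assume "finite (solutions n a b {..<m}) \<and> card (solutions n a b {..<m}) = k"
  hence K: "finite K" "card K = k" by (auto simp: K_def)
  define \<I> where "\<I> = {I. I \<subseteq> {..<m} \<and> solutions n a b I = K}"
  have "finite \<I>" "{..<m} \<in> \<I>" by (auto simp: \<I>_def K_def)
  then obtain I where "I \<in> \<I>" and least: "\<And>J. J \<in> \<I> \<Longrightarrow> card I \<le> card J"
    using ex_is_arg_min_if_finite[of \<I> card] by (auto simp: is_arg_min_linorder)
  hence I: "I \<subseteq> {..<m}" "solutions n a b I = K" by (auto simp: \<I>_def)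
  have finI: "finite I" using I(1) finite_subset by blast
  have "\<exists>x. x \<in> int_lattice n \<and> b i < lin n (a i) x \<and> (\<forall>j\<in>I - {i}. lin n (a j) x \<le> b j)"
    if i: "i \<in> I" for i
  proof -
    have "card (I - {i}) < card I" using i finI by (meson card_Diff1_less)
    hence "solutions n a b (I - {i}) \<noteq> K" using least[of "I - {i}"] I by (auto simp: \<I>_def)
    moreover have "K \<subseteq> solutions n a b (I - {i})" using I(2) by (auto simp: solutions_def)
    ultimately obtain x where x: "x \<in> solutions n a b (I - {i})" "x \<notin> solutions n a b I"
      using I(2) by blast
    hence "b i < lin n (a i) x" unfolding solutions_def by force
    thus ?thesis using x(1) by (auto simp: solutions_def)
  qed
  then obtain w where w: "\<And>i. i \<in> I \<Longrightarrow> w i \<in> int_lattice n \<and> b i < lin n (a i) (w i) \<and>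
      (\<forall>j\<in>I - {i}. lin n (a j) (w i) \<le> b j)" by metis
  have KL: "K \<subseteq> int_lattice n" by (simp add: K_def solutions_subset_lattice)
  obtain B where B: "w ` I \<union> K \<subseteq> box n B"
    using finite_subset_box[of "w ` I \<union> K" n] w KL K finI by auto
  have wit: "\<exists>x\<in>box n B. b i < lin n (a i) x \<and> (\<forall>j\<in>I - {i}. lin n (a j) x \<le> b j)" if "i \<in> I" for i
    using w[OF that] B that by blast
  obtain v where v: "\<And>i. i \<in> I \<Longrightarrow> v i \<in> box n B" "\<And>i. i \<in> I \<Longrightarrow> b i < lin n (a i) (v i)"
    "\<And>i j. i \<in> I \<Longrightarrow> j \<in> I \<Longrightarrow> i \<noteq> j \<Longrightarrow> lin n (a j) (v i) < lin n (a j) (v j)"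
    "\<And>x. x \<in> box n B \<Longrightarrow> (\<And>i. i \<in> I \<Longrightarrow> lin n (a i) x < lin n (a i) (v i)) \<Longrightarrow>
      (\<forall>i\<in>I. lin n (a i) x \<le> b i)"
    by (rule tighten_thresholds[of I "box n B" b "\<lambda>i. lin n (a i)", OF finI finite_box wit]) blast+
  have inK: "lin n (a i) q \<le> b i" if "q \<in> K" "i \<in> I" for q i
    using that I(2) by (auto simp: solutions_def)
  have cfg: "separated_config n (v ` I) K"
    unfolding separated_config_def
  proof (intro conjI ballI)
    show "v ` I \<inter> K = {}" using v(2) inK by fastforce
    show "v ` I \<subseteq> int_lattice n" using v(1) by (auto simp: box_def)
    fix p assume p: "p \<in> int_lattice n - K"
    show "\<exists>a. \<forall>q\<in>v ` I \<union> K - {p}. lin n a q < lin n a p"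
    proof (cases "p \<in> box n B")
      case False
      obtain i s where "lin n (coord i s) p > of_int B"
        "\<And>q. q \<in> box n B \<Longrightarrow> lin n (coord i s) q \<le> of_int B"
        using separates_from_box[OF _ False] p by blast
      moreover have "v ` I \<union> K \<subseteq> box n B" using v(1) B by auto
      ultimately show ?thesis by (intro exI[of _ "coord i s"]) force
    next
      case True
      have "\<not> (\<forall>i\<in>I. lin n (a i) p \<le> b i)" using p I(2) by (auto simp: solutions_def)
      then obtain i where i: "i \<in> I" "lin n (a i) (v i) \<le> lin n (a i) p"
        using v(4)[OF True] by (meson not_le)
      have less: "lin n (a i) q < lin n (a i) (v i)" if "q \<in> v ` I \<union> K" "q \<noteq> v i" for q
        using that v(3)[of _ i] i(1) inK[of q i] v(2)[OF i(1)] by fastforce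
      show ?thesis
      proof (cases "p = v i")
        case True
        thus ?thesis using less by (intro exI[of _ "a i"]) auto
      next
        case False
        have "v i \<in> int_lattice n" "p \<in> int_lattice n" using v(1)[OF i(1)] p by (auto simp: box_def)
        moreover have "finite (v ` I \<union> K)" using finI K by simp
        moreover have "lin n (a i) q < lin n (a i) p" if "q \<in> v ` I \<union> K" "q \<noteq> v i" for q
          using less[OF that] i by simp
        ultimately obtain a' where "\<And>q. q \<in> insert (v i) (v ` I \<union> K) \<Longrightarrow> lin n a' q < lin n a' p"
          using separate_tied_point[of "v ` I \<union> K" p n "v i" "a i"] False i by metis
        thus ?thesis by (intro exI[of _ a']) auto
      qed
    qed
  qed (use finI K KL in auto)
  have "inj_on v I" using v(3) by (intro inj_onI) force
  hence "card I \<le> c" using bound[OF cfg K(2)] by (simp add: card_image)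
  thus "\<exists>I\<subseteq>{..<m}. card I \<le> c \<and> solutions n a b I = solutions n a b {..<m}"
    using I by (auto simp: K_def)
qed

section \<open>Parity classes\<close>

lemma lin_scale_right: "lin n a (\<lambda>i. c * x i) = of_int c * lin n a x"
  by (simp add: lin_def sum_distrib_left algebra_simps)

lemma lin_add_right: "lin n a (\<lambda>i. x i + y i) = lin n a x + lin n a y"
  by (simp add: lin_def sum.distrib algebra_simps)

definition parity :: "(nat \<Rightarrow> int) \<Rightarrow> nat set" where
  "parity x = {i. odd (x i)}"

lemma parity_in_Pow: "x \<in> int_lattice n \<Longrightarrow> parity x \<in> Pow {..<n}"
  by (auto simp: parity_def int_lattice_def not_le[symmetric])

text \<open>A linear functional takes at a midpoint the mean of its values at the two ends, so the
  midpoint cannot be separated from them and must be exempt from separation.\<close>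
lemma midpoint_in_core:
  assumes cfg: "separated_config n V K" and uv: "u \<in> V \<union> K" "v \<in> V \<union> K" "u \<noteq> v" "parity u = parity v"
  obtains m where "m \<in> K" "\<And>i. 2 * m i = u i + v i"
proof -
  define m where "m = (\<lambda>i. (u i + v i) div 2)"
  have m: "2 * m i = u i + v i" for i
  proof -
    have "odd (u i) \<longleftrightarrow> odd (v i)" using uv(4) by (auto simp: parity_def)
    thus ?thesis by (simp add: m_def)
  qed
  have "u \<in> int_lattice n" "v \<in> int_lattice n" using uv configD[OF cfg] by auto
  hence "m \<in> int_lattice n" by (simp add: int_lattice_def m_def)
  have "m \<in> K"
  proof (rule ccontr)
    assume "m \<notin> K"
    then obtain a where a: "\<forall>q\<in>V \<union> K - {m}. lin n a q < lin n a m"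
      using configD(6)[OF cfg \<open>m \<in> int_lattice n\<close>] by blast
    have "m \<noteq> u" "m \<noteq> v"
    proof -
      obtain i where "u i \<noteq> v i" using uv(3) by blast
      thus "m \<noteq> u" "m \<noteq> v" using m[of i] by auto
    qed
    hence "lin n a u + lin n a v < 2 * lin n a m" using a uv by (smt (verit) DiffI singletonD)
    moreover have "2 * lin n a m = lin n a u + lin n a v"
      using lin_scale_right[of n a 2 m] lin_add_right[of n a u v] by (simp add: m)
    ultimately show False by simp
  qed
  thus thesis using m that by blast
qed

lemma card_le_parity_fibres:
  assumes "finite S" "S \<subseteq> int_lattice n" and "\<And>P. P \<in> \<P> \<Longrightarrow> card {v \<in> S. parity v = P} \<le> r"
    and "parity ` S \<subseteq> \<P>" "\<P> \<subseteq> Pow {..<n}"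
  shows "card S \<le> card \<P> * r"
proof -
  have fin: "finite \<P>" using assms(5) by (rule finite_subset) simp
  have "S = (\<Union>P\<in>\<P>. {v \<in> S. parity v = P})" using assms(4) by auto
  hence "card S \<le> (\<Sum>P\<in>\<P>. card {v \<in> S. parity v = P})"
    using card_UN_le[OF fin, of "\<lambda>P. {v \<in> S. parity v = P}"] by simp
  also have "\<dots> \<le> card \<P> * r" using sum_bounded_above[of \<P> _ r] assms(3) by force
  finally show ?thesis .
qed

text \<open>The bound is crude, but shows that some number of rows always suffices, so that the least
  such number has this property. Within one parity class, the midpoints with a fixed point \<open>u\<close> are distinct points of \<open>K\<close>.\<close>
lemma card_config_le:
  assumes cfg: "separated_config n V K"
  shows "card V \<le> 2 ^ n * (card K + 1)"
proof -
  note C = configD[OF cfg]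
  have "card {v \<in> V. parity v = P} \<le> card K + 1" for P
  proof (cases "{v \<in> V. parity v = P} = {}")
    case False
    then obtain u where u: "u \<in> V" "parity u = P" by blast
    define F where "F = {v \<in> V. parity v = P}"
    have F: "finite F" "u \<in> F" using C u by (auto simp: F_def)
    have "\<exists>m\<in>K. \<forall>i. 2 * m i = u i + v i" if "v \<in> F - {u}" for v
    proof -
      have "u \<in> V \<union> K" "v \<in> V \<union> K" "u \<noteq> v" "parity u = parity v"
        using that u by (auto simp: F_def)
      from midpoint_in_core[OF cfg this] show ?thesis by metis
    qed
    then obtain h where h: "\<And>v. v \<in> F - {u} \<Longrightarrow> h v \<in> K \<and> (\<forall>i. 2 * h v i = u i + v i)" by metis
    have "inj_on h (F - {u})"
    proof (rule inj_onI, rule ext)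
      fix v w i assume vw: "v \<in> F - {u}" "w \<in> F - {u}" "h v = h w"
      have "2 * h v i = u i + v i" "2 * h w i = u i + w i" using h vw by blast+
      thus "v i = w i" using vw(3) by simp
    qed
    hence "card (F - {u}) \<le> card K" using h C(2) by (intro card_inj_on_le) auto
    thus ?thesis using F by (simp add: card_Diff_singleton F_def)
  next
    case True
    show ?thesis unfolding True by simp
  qed
  moreover have "parity ` V \<subseteq> Pow {..<n}" using C(3) parity_in_Pow by blast
  ultimately have "card V \<le> card (Pow {..<n}) * (card K + 1)"
    using C by (intro card_le_parity_fibres[of V n]) auto
  thus ?thesis by (simp add: card_Pow)
qed

lemma card_config_le_doignon_number:
  assumes "separated_config n V K"
  shows "card V \<le> doignon_number n (card K)"
proof -
  have "selects_rows n (card K) (2 ^ n * (card K + 1))"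
    using card_config_le by (intro selects_rows_if_card_config_le) metis
  hence "selects_rows n (card K) (doignon_number n (card K))"
    unfolding doignon_number_def by (rule LeastI)
  thus ?thesis using card_config_le_if_selects_rows assms by blast
qed

lemma doignon_number_le:
  assumes "\<And>V K. separated_config n V K \<Longrightarrow> card K = k \<Longrightarrow> card V \<le> c"
  shows "doignon_number n k \<le> c"
  unfolding doignon_number_def using selects_rows_if_card_config_le[OF assms] by (rule Least_le)

section \<open>Integer vectors inside a sublattice with a basis\<close>

definition int_span :: "nat \<Rightarrow> (nat \<Rightarrow> nat \<Rightarrow> int) \<Rightarrow> (nat \<Rightarrow> int) set" where
  "int_span d u = {x. \<exists>z. \<forall>j. x j = (\<Sum>l<d. z l * u l j)}"

definition int_independent :: "nat \<Rightarrow> (nat \<Rightarrow> nat \<Rightarrow> int) \<Rightarrow> bool" where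
  "int_independent d u \<longleftrightarrow> (\<forall>z. (\<forall>j. (\<Sum>l<d. z l * u l j) = 0) \<longrightarrow> (\<forall>l<d. z l = 0))"

lemma int_span_add_scaled:
  assumes "x \<in> int_span d u" "y \<in> int_span d u"
  shows "(\<lambda>j. x j + c * y j) \<in> int_span d u"
proof -
  obtain z z' where "\<forall>j. x j = (\<Sum>l<d. z l * u l j)" "\<forall>j. y j = (\<Sum>l<d. z' l * u l j)"
    using assms by (auto simp: int_span_def)
  hence "\<forall>j. x j + c * y j = (\<Sum>l<d. (z l + c * z' l) * u l j)"
    by (simp add: sum.distrib sum_distrib_left algebra_simps)
  thus ?thesis unfolding int_span_def by (intro CollectI exI[of _ "\<lambda>l. z l + c * z' l"])
qed

lemma int_span_base:
  assumes "i < d" shows "u i \<in> int_span d u"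
proof -
  have "\<forall>j. u i j = (\<Sum>l<d. (if l = i then 1 else 0) * u l j)"
    using assms by (simp add: if_distrib[of "\<lambda>t. t * _"] cong: if_cong)
  thus ?thesis unfolding int_span_def by (intro CollectI exI[of _ "\<lambda>l. if l = i then 1 else 0"])
qed

lemma int_span_extend:
  assumes "x \<in> int_span e u" shows "x \<in> int_span (Suc e) (u(e := y))"
proof -
  obtain z where "\<forall>j. x j = (\<Sum>l<e. z l * u l j)" using assms by (auto simp: int_span_def)
  hence "\<forall>j. x j = (\<Sum>l<Suc e. (z(e := 0)) l * (u(e := y)) l j)" by simp
  thus ?thesis unfolding int_span_def by blast
qed

lemma lattice_SucD:
  assumes "x n = 0" "x \<in> int_lattice (Suc n)" shows "x \<in> int_lattice n"
  unfolding int_lattice_def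
proof (intro CollectI allI impI)
  fix i assume "n \<le> i"
  thus "x i = 0" using assms by (cases "i = n") (auto simp: int_lattice_def)
qed

text \<open>Euclid's algorithm on the last coordinate: subtracting one vector from another shrinks the
  sum of the absolute last coordinates until at most one vector has a nonzero one. That vector
  is independent of the others, which live in dimension \<open>n\<close>. If all last coordinates vanish, all
  \<open>d\<close> vectors live there; should \<open>d\<close> exceed that dimension, the unit vectors serve as \<open>u\<close>.
  The \<open>w i\<close> may be dependent, so the span of \<open>u\<close> can be larger than theirs.\<close>
lemma ex_independent_spanning:
  assumes "d \<le> n" "\<And>i. i < d \<Longrightarrow> w i \<in> int_lattice n"
  shows "\<exists>u. (\<forall>l<d. u l \<in> int_lattice n) \<and> int_independent d u \<and> (\<forall>i<d. w i \<in> int_span d u)"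
  using assms
proof (induction n arbitrary: d w)
  case 0
  thus ?case by (simp add: int_independent_def)
next
  case (Suc n)
  note IH = Suc.IH
  from Suc.prems show ?case
  proof (induction "\<Sum>i<d. nat \<bar>w i n\<bar>" arbitrary: w rule: less_induct)
    case less
    consider (two) i j where "i < d" "j < d" "i \<noteq> j" "w j n \<noteq> 0" "\<bar>w j n\<bar> \<le> \<bar>w i n\<bar>"
      | (one) i where "i < d" "w i n \<noteq> 0" "\<And>j. j < d \<Longrightarrow> j \<noteq> i \<Longrightarrow> w j n = 0"
      | (none) "\<And>i. i < d \<Longrightarrow> w i n = 0"
      by (metis linorder_le_cases)
    thus ?case
    proof cases
      case two
      define s where "s = sgn (w i n) * sgn (w j n)"
      define w' where "w' = w(i := (\<lambda>l. w i l + (- s) * w j l))"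
      have smaller: "\<bar>w' i n\<bar> < \<bar>w i n\<bar>"
        using two(3-5) by (auto simp: w'_def s_def sgn_if abs_if split: if_splits)
      have "(\<Sum>l<d. nat \<bar>w' l n\<bar>) < (\<Sum>l<d. nat \<bar>w l n\<bar>)"
      proof (rule sum_strict_mono_ex1)
        show "\<forall>l\<in>{..<d}. nat \<bar>w' l n\<bar> \<le> nat \<bar>w l n\<bar>"
        proof
          fix l show "nat \<bar>w' l n\<bar> \<le> nat \<bar>w l n\<bar>"
            using smaller by (cases "l = i") (auto simp: w'_def)
        qed
        show "\<exists>l\<in>{..<d}. nat \<bar>w' l n\<bar> < nat \<bar>w l n\<bar>"
          using smaller two(1) by (intro bexI[of _ i]) auto
      qed simp
      moreover have "w' l \<in> int_lattice (Suc n)" if "l < d" for l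
        using less.prems(2)[OF that] less.prems(2)[OF two(1)] less.prems(2)[OF two(2)]
        by (auto simp: w'_def int_lattice_def)
      ultimately obtain u where u: "\<forall>l<d. u l \<in> int_lattice (Suc n)" "int_independent d u"
        "\<forall>l<d. w' l \<in> int_span d u"
        using less.hyps[of w'] less.prems(1) by blast
      have "w l \<in> int_span d u" if "l < d" for l
      proof (cases "l = i")
        case True
        have "w' j = w j" using two(3) by (simp add: w'_def)
        hence "(\<lambda>l. w' i l + s * w j l) \<in> int_span d u"
          using int_span_add_scaled[of "w' i" d u "w j" s] u(3) two by auto
        thus ?thesis by (simp add: True w'_def)
      next
        case False
        have "w' l = w l" using False by (simp add: w'_def)
        thus ?thesis using u(3) that by metis
      qed
      thus ?thesis using u by blast
    next
      case one
      obtain e where e: "d = Suc e" using one(1) by (cases d) auto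
      define w' where "w' l = (if l = i then w e else w l)" for l
      have "w' l \<in> int_lattice n" if "l < e" for l
      proof -
        define l' where "l' = (if l = i then e else l)"
        have "l' < d" "l' \<noteq> i" using that e by (auto simp: l'_def)
        hence "w l' n = 0" "w l' \<in> int_lattice (Suc n)" using one(3) less.prems by auto
        hence "w l' \<in> int_lattice n" by (rule lattice_SucD)
        thus ?thesis by (simp add: w'_def l'_def split: if_splits)
      qed
      moreover have "e \<le> n" using less.prems(1) e by simp
      ultimately obtain u where u: "\<forall>l<e. u l \<in> int_lattice n" "int_independent e u"
        "\<forall>l<e. w' l \<in> int_span e u" using IH[of e w'] by blast
      define v where "v = u(e := w i)"
      have "v l \<in> int_lattice (Suc n)" if "l < d" for l
        using u(1) less.prems(2)[OF one(1)] that e by (auto simp: v_def int_lattice_def less_Suc_eq)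
      moreover have "int_independent d v"
        unfolding int_independent_def
      proof (rule allI, rule impI)
        fix z assume z: "\<forall>j. (\<Sum>l<d. z l * v l j) = 0"
        have z': "(\<Sum>l<e. z l * u l j) + z e * w i j = 0" for j
          using z[rule_format, of j] by (simp add: e v_def)
        have "(\<Sum>l<e. z l * u l n) = 0" using u(1) by (intro sum.neutral) (simp add: int_lattice_def)
        hence "z e = 0" using z'[of n] one(2) by simp
        hence "\<forall>l<e. z l = 0" using z' u(2) by (simp add: int_independent_def)
        thus "\<forall>l<d. z l = 0" using \<open>z e = 0\<close> e by (simp add: less_Suc_eq)
      qed
      moreover have "w l \<in> int_span d v" if "l < d" for l
      proof (cases "l = i")
        case True
        have "v e = w i" by (simp add: v_def)
        thus ?thesis using int_span_base[of e d v] e True by simp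
      next
        case False
        define l' where "l' = (if l = e then i else l)"
        have "l' < e" "w' l' = w l" using that e False one(1) by (auto simp: l'_def w'_def)
        hence "w l \<in> int_span e u" using u(3) by metis
        thus ?thesis unfolding v_def e by (rule int_span_extend)
      qed
      ultimately show ?thesis by blast
    next
      case none
      show ?thesis
      proof (cases "d \<le> n")
        case True
        have "w i \<in> int_lattice n" if "i < d" for i
          using none[OF that] less.prems(2)[OF that] by (rule lattice_SucD)
        then obtain u where "\<forall>l<d. u l \<in> int_lattice n" "int_independent d u" "\<forall>i<d. w i \<in> int_span d u"
          using IH[OF True] by blast
        moreover have "int_lattice n \<subseteq> int_lattice (Suc n)" by (auto simp: int_lattice_def)
        ultimately show ?thesis by blast
      next
        case False
        hence d: "d = Suc n" using less.prems(1) by simp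
        define u :: "nat \<Rightarrow> nat \<Rightarrow> int" where "u l j = (if j = l then 1 else 0)" for l j
        have sum_u: "(\<Sum>l<d. z l * u l j) = (if j < d then z j else 0)" for z j
          by (simp add: u_def if_distrib[of "\<lambda>t. _ * t"] cong: if_cong)
        have "\<forall>l<d. u l \<in> int_lattice (Suc n)" by (auto simp: u_def int_lattice_def d)
        moreover have "int_independent d u"
          unfolding int_independent_def sum_u by (metis)
        moreover have "w i \<in> int_span d u" if "i < d" for i
          using less.prems(2)[OF that] unfolding int_span_def sum_u
          by (intro CollectI exI[of _ "w i"]) (auto simp: int_lattice_def d)
        ultimately show ?thesis by blast
      qed
    qed
  qed
qed

section \<open>The upper bound\<close>

text \<open>Take two points of \<open>K\<close> at minimal distance. If they were congruent modulo 2, their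
  midpoint would be in \<open>K\<close> and closer to either of them.\<close>
lemma core_has_two_parities:
  assumes cfg: "separated_config n V K" and two: "2 \<le> card K"
  shows "2 \<le> card (parity ` K)"
proof -
  note C = configD[OF cfg]
  define D where "D = {(p, q). p \<in> K \<and> q \<in> K \<and> p \<noteq> q}"
  define dist where "dist = (\<lambda>(p, q). \<Sum>i<n. \<bar>p i - q i :: int\<bar>)"
  have "D \<subseteq> K \<times> K" by (auto simp: D_def)
  hence "finite D" using C(2) finite_subset by blast
  moreover have "D \<noteq> {}"
  proof -
    obtain p q where "p \<in> K" "q \<in> K" "p \<noteq> q"
      using two C(2) by (metis One_nat_def card_le_Suc0_iff_eq not_less_eq_eq numeral_2_eq_2)
    thus ?thesis by (auto simp: D_def)
  qed
  ultimately obtain pq where pq: "pq \<in> D" "\<And>xy. xy \<in> D \<Longrightarrow> dist pq \<le> dist xy"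
    using ex_is_arg_min_if_finite[of D dist] by (auto simp: is_arg_min_linorder)
  obtain p q where [simp]: "pq = (p, q)" by (cases pq)
  have D: "p \<in> K" "q \<in> K" "p \<noteq> q" using pq(1) by (auto simp: D_def)
  have "parity p \<noteq> parity q"
  proof
    assume "parity p = parity q"
    then obtain m where m: "m \<in> K" "\<And>i. 2 * m i = p i + q i"
      using midpoint_in_core[OF cfg, of p q] D by auto
    obtain i where i: "p i \<noteq> q i" using D(3) by blast
    have "i < n"
    proof (rule ccontr)
      assume "\<not> i < n"
      hence "p i = 0" "q i = 0" using D C(4) by (auto simp: int_lattice_def)
      thus False using i by simp
    qed
    have "2 * dist (p, m) = (\<Sum>i<n. \<bar>p i - q i\<bar>)"
      unfolding dist_def prod.case sum_distrib_left
    proof (intro sum.cong refl)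
      fix i
      have "p i - q i = 2 * (p i - m i)" using m(2)[of i] by simp
      thus "2 * \<bar>p i - m i\<bar> = \<bar>p i - q i\<bar>" by (simp only: abs_mult)
    qed
    moreover have "(\<Sum>i<n. \<bar>p i - q i\<bar>) > 0"
      using i \<open>i < n\<close> by (intro sum_pos2[of _ i]) auto
    moreover have "(p, m) \<in> D"
    proof -
      have "m i \<noteq> p i" using m(2)[of i] i by linarith
      thus ?thesis using D m by (auto simp: D_def)
    qed
    hence "dist (p, q) \<le> dist (p, m)" using pq(2) by simp
    ultimately show False by (simp add: dist_def)
  qed
  hence "card {parity p, parity q} = 2" by simp
  moreover have "card {parity p, parity q} \<le> card (parity ` K)"
    using D C(2) by (intro card_mono) auto
  ultimately show ?thesis by simp
qed

text \<open>With midpoints \<open>p\<close>, \<open>q\<close>, \<open>r\<close> of \<open>x y\<close>, \<open>x z\<close>, \<open>y z\<close> one has \<open>x = p + q - r\<close>,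
  so a parity class contains at most two points of \<open>V\<close> off \<open>H\<close>; and a point whose midpoint
  \<open>m\<close> with some \<open>h \<in> K\<close> lies in \<open>K\<close> equals \<open>m + m - h\<close>, so it is in \<open>H\<close>.\<close>
lemma card_off_affine_lattice:
  assumes cfg: "separated_config n V K" and two: "2 \<le> card K" and KH: "K \<subseteq> H"
    and affine: "\<And>p q r. p \<in> H \<Longrightarrow> q \<in> H \<Longrightarrow> r \<in> H \<Longrightarrow> (\<lambda>i. p i + q i - r i) \<in> H"
  shows "card (V - H) \<le> 2 * (2 ^ n - 2)"
proof -
  note C = configD[OF cfg]
  let ?\<P> = "Pow {..<n} - parity ` K"
  have "parity v \<notin> parity ` K" if v: "v \<in> V - H" for v
  proof
    assume "parity v \<in> parity ` K"
    then obtain h where h: "h \<in> K" "parity v = parity h" by blast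
    have "v \<noteq> h" using h v C(5) by auto
    then obtain m where m: "m \<in> K" "\<And>i. 2 * m i = v i + h i"
      using midpoint_in_core[OF cfg, of v h] h v by auto
    have "v = (\<lambda>i. m i + m i - h i)"
    proof
      fix i show "v i = m i + m i - h i" using m(2)[of i] by simp
    qed
    thus False using affine[of m m h] m(1) h(1) KH v by auto
  qed
  hence "parity ` (V - H) \<subseteq> ?\<P>" using C(3) parity_in_Pow by blast
  moreover have "card {v \<in> V - H. parity v = P} \<le> 2" for P
  proof (rule ccontr)
    let ?F = "{v \<in> V - H. parity v = P}"
    assume "\<not> card ?F \<le> 2"
    hence "3 \<le> card ?F" by simp
    then obtain T where T: "T \<subseteq> ?F" "card T = 3" by (rule obtain_subset_with_card_n)
    then obtain x y z where xyz: "x \<in> ?F" "y \<in> ?F" "z \<in> ?F" "x \<noteq> y" "y \<noteq> z" "x \<noteq> z"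
      by (auto simp: card_3_iff)
    obtain p where p: "p \<in> K" "\<And>i. 2 * p i = x i + y i"
      using midpoint_in_core[OF cfg, of x y] xyz by auto
    obtain q where q: "q \<in> K" "\<And>i. 2 * q i = x i + z i"
      using midpoint_in_core[OF cfg, of x z] xyz by auto
    obtain r where r: "r \<in> K" "\<And>i. 2 * r i = y i + z i"
      using midpoint_in_core[OF cfg, of y z] xyz by auto
    have "x = (\<lambda>i. p i + q i - r i)"
    proof
      fix i show "x i = p i + q i - r i" using p(2)[of i] q(2)[of i] r(2)[of i] by simp
    qed
    thus False using affine[of p q r] p(1) q(1) r(1) KH xyz(1) by auto
  qed
  ultimately have "card (V - H) \<le> card ?\<P> * 2"
    using C by (intro card_le_parity_fibres[of _ n]) auto
  also have "card ?\<P> = 2 ^ n - card (parity ` K)"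
  proof -
    have "parity ` K \<subseteq> Pow {..<n}" using C(4) parity_in_Pow by blast
    thus ?thesis using C(2) by (simp add: card_Diff_subset card_Pow)
  qed
  finally show ?thesis using core_has_two_parities[OF cfg two] by simp
qed

text \<open>The differences of the points of \<open>K\<close> to one of them are \<open>d\<close> vectors, possibly
  dependent; a basis of a sublattice containing them gives the map. Its image need not contain
  all integer points of its affine hull. Injectivity is what keeps the number of points of
  \<open>K\<close> unchanged under preimages.\<close>
lemma ex_affine_lattice_map:
  assumes K: "finite K" "K \<subseteq> int_lattice n" "card K = Suc d" and "d \<le> n"
  obtains c u \<phi> where "\<phi> = (\<lambda>z j. c j + (\<Sum>l<d. z l * u l j))" "inj_on \<phi> (int_lattice d)"
    "\<phi> ` int_lattice d \<subseteq> int_lattice n" "K \<subseteq> \<phi> ` int_lattice d"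
proof -
  obtain e where e: "bij_betw e {0..<Suc d} K" using ex_bij_betw_nat_finite[OF K(1)] K(3) by auto
  define c where "c = e d"
  have eK: "e i \<in> K" if "i \<le> d" for i using bij_betwE[OF e] that by auto
  define w where "w i = (\<lambda>j. e i j - c j)" for i
  have "w i \<in> int_lattice n" if "i < d" for i
  proof -
    have "e i \<in> int_lattice n" "e d \<in> int_lattice n" using eK[of i] eK[of d] that K(2) by auto
    thus ?thesis by (simp add: w_def c_def int_lattice_def)
  qed
  then obtain u where u: "\<forall>l<d. u l \<in> int_lattice n" "int_independent d u" "\<forall>i<d. w i \<in> int_span d u"
    using ex_independent_spanning[OF \<open>d \<le> n\<close>, of w] by blast
  define \<phi> where "\<phi> = (\<lambda>z j. c j + (\<Sum>l<d. z l * u l j))"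
  have "inj_on \<phi> (int_lattice d)"
  proof (rule inj_onI, rule ext)
    fix y z l assume yz: "y \<in> int_lattice d" "z \<in> int_lattice d" "\<phi> y = \<phi> z"
    have "(\<Sum>l<d. (y l - z l) * u l j) = 0" for j
      using fun_cong[OF yz(3), of j] by (simp add: \<phi>_def left_diff_distrib sum_subtractf)
    hence "\<forall>l<d. y l - z l = 0" using u(2)[unfolded int_independent_def, rule_format, of "\<lambda>l. y l - z l"]
      by blast
    thus "y l = z l" using yz(1,2) by (cases "l < d") (auto simp: int_lattice_def)
  qed
  moreover have "\<phi> ` int_lattice d \<subseteq> int_lattice n"
  proof -
    have "c \<in> int_lattice n" using eK[of d] K(2) by (auto simp: c_def)
    moreover have "(\<Sum>l<d. z l * u l j) = 0" if "n \<le> j" for z j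
      using u(1) that by (intro sum.neutral) (simp add: int_lattice_def)
    ultimately show ?thesis by (auto simp: \<phi>_def int_lattice_def)
  qed
  moreover have "K \<subseteq> \<phi> ` int_lattice d"
  proof
    fix x assume "x \<in> K"
    then obtain i where i: "i \<le> d" "x = e i" using e by (auto simp: bij_betw_def less_Suc_eq_le)
    show "x \<in> \<phi> ` int_lattice d"
    proof (cases "i = d")
      case True
      have "\<phi> (\<lambda>_. 0) = x" using i True by (simp add: \<phi>_def c_def)
      thus ?thesis by (intro image_eqI[of _ _ "\<lambda>_. 0"]) (auto simp: int_lattice_def)
    next
      case False
      hence "w i \<in> int_span d u" using u(3) i(1) by simp
      then obtain z where z: "\<forall>j. w i j = (\<Sum>l<d. z l * u l j)"
        by (auto simp: int_span_def)
      have "\<phi> (\<lambda>l. if l < d then z l else 0) = x"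
      proof
        fix j show "\<phi> (\<lambda>l. if l < d then z l else 0) j = x j"
          using z[rule_format, of j] by (simp add: \<phi>_def w_def i)
      qed
      thus ?thesis
        by (intro image_eqI[of _ _ "\<lambda>l. if l < d then z l else 0"]) (auto simp: int_lattice_def)
    qed
  qed
  ultimately show thesis using that[of \<phi> c u] \<phi>_def by blast
qed

text \<open>A functional composed with an affine map is a functional up to a constant, so separators
  pull back.\<close>
lemma config_vimage:
  assumes cfg: "separated_config n V K" and \<phi>: "\<phi> = (\<lambda>z j. c j + (\<Sum>l<d. z l * u l j))"
    and inj: "inj_on \<phi> (int_lattice d)" and im: "\<phi> ` int_lattice d \<subseteq> int_lattice n"
  shows "separated_config d (\<phi> -` V \<inter> int_lattice d) (\<phi> -` K \<inter> int_lattice d)"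
  unfolding separated_config_def
proof (intro conjI ballI)
  note C = configD[OF cfg]
  fix p assume p: "p \<in> int_lattice d - (\<phi> -` K \<inter> int_lattice d)"
  obtain a where a: "\<forall>q\<in>V \<union> K - {\<phi> p}. lin n a q < lin n a (\<phi> p)"
    using C(6)[of "\<phi> p"] p im by blast
  have lin_\<phi>: "lin n a (\<phi> z) = lin n a c + lin d (\<lambda>l. lin n a (u l)) z" for z
  proof -
    have "lin n a (\<lambda>j. \<Sum>l<d. z l * u l j) = (\<Sum>i<n. \<Sum>l<d. a i * of_int (u l i) * of_int (z l))"
      by (simp add: lin_def sum_distrib_left mult_ac)
    also have "\<dots> = lin d (\<lambda>l. lin n a (u l)) z"
      unfolding lin_def sum_distrib_right by (rule sum.swap)
    finally show ?thesis unfolding \<phi> lin_add_right by simp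
  qed
  show "\<exists>a. \<forall>q\<in>\<phi> -` V \<inter> int_lattice d \<union> \<phi> -` K \<inter> int_lattice d - {p}. lin d a q < lin d a p"
  proof (intro exI ballI)
    fix q assume q: "q \<in> \<phi> -` V \<inter> int_lattice d \<union> \<phi> -` K \<inter> int_lattice d - {p}"
    hence "\<phi> q \<noteq> \<phi> p" using p inj by (auto dest: inj_onD)
    hence "lin n a (\<phi> q) < lin n a (\<phi> p)" using a q by auto
    thus "lin d (\<lambda>l. lin n a (u l)) q < lin d (\<lambda>l. lin n a (u l)) p" by (simp add: lin_\<phi>)
  qed
qed (use configD[OF cfg] inj in \<open>auto intro: finite_vimage_IntI\<close>)

lemma doignon_number_upper:
  assumes "2 \<le> k" "k \<le> n"
  shows "doignon_number n k \<le> doignon_number (k - 1) k + 2 * (2 ^ n - 2)"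
proof (rule doignon_number_le)
  fix V K assume cfg: "separated_config n V K" and k: "card K = k"
  note C = configD[OF cfg]
  define d where "d = k - 1"
  have d: "card K = Suc d" "d \<le> n" using assms k by (auto simp: d_def)
  obtain c u \<phi> where \<phi>: "\<phi> = (\<lambda>z j. c j + (\<Sum>l<d. z l * u l j))" "inj_on \<phi> (int_lattice d)"
    "\<phi> ` int_lattice d \<subseteq> int_lattice n" "K \<subseteq> \<phi> ` int_lattice d"
    by (rule ex_affine_lattice_map[OF C(2,4) d])
  define H where "H = \<phi> ` int_lattice d"
  have card_vimage: "card (\<phi> -` S \<inter> int_lattice d) = card (S \<inter> H)" for S
  proof -
    have "\<phi> ` (\<phi> -` S \<inter> int_lattice d) = S \<inter> H" by (auto simp: H_def)
    moreover have "inj_on \<phi> (\<phi> -` S \<inter> int_lattice d)" using \<phi>(2) by (rule inj_on_subset) auto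
    ultimately show ?thesis by (metis card_image)
  qed
  have "card (V \<inter> H) \<le> doignon_number d (card (K \<inter> H))"
    using card_config_le_doignon_number[OF config_vimage[OF cfg \<phi>(1-3)]] by (simp add: card_vimage)
  also have "K \<inter> H = K" using \<phi>(4) by (auto simp: H_def)
  finally have on: "card (V \<inter> H) \<le> doignon_number (k - 1) k" by (simp add: k d_def)
  have "(\<lambda>j. p j + q j - r j) \<in> H" if pqr: "p \<in> H" "q \<in> H" "r \<in> H" for p q r
  proof -
    obtain x y z where xyz: "x \<in> int_lattice d" "y \<in> int_lattice d" "z \<in> int_lattice d"
      "p = \<phi> x" "q = \<phi> y" "r = \<phi> z" using pqr by (auto simp: H_def)
    have "(\<lambda>j. p j + q j - r j) = \<phi> (\<lambda>l. x l + y l - z l)"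
      by (simp add: xyz \<phi>(1) fun_eq_iff algebra_simps sum.distrib sum_subtractf)
    moreover have "(\<lambda>l. x l + y l - z l) \<in> int_lattice d" using xyz by (auto simp: int_lattice_def)
    ultimately show ?thesis by (simp add: H_def)
  qed
  hence off: "card (V - H) \<le> 2 * (2 ^ n - 2)"
    using card_off_affine_lattice[OF cfg, of H] assms k \<phi>(4) by (auto simp: H_def)
  have "card V = card (V \<inter> H) + card (V - H)"
    using card_Un_disjoint[of "V \<inter> H" "V - H"] C(1) by (auto simp: Int_Diff_Un)
  thus "card V \<le> doignon_number (k - 1) k + 2 * (2 ^ n - 2)" using on off by simp
qed

section \<open>The lower bound\<close>

text \<open>The union \<open>V \<union> K\<close> is unchanged and there is one point less to separate.\<close>
lemma config_move_to_core:
  assumes "separated_config n V K" "v \<in> V"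
  shows "separated_config n (V - {v}) (insert v K)"
proof -
  have "V - {v} \<union> insert v K = V \<union> K" using assms(2) by auto
  thus ?thesis using assms unfolding separated_config_def by auto
qed

lemma config_shrink:
  assumes "separated_config n V K" "j \<le> card V"
  shows "\<exists>V' K'. separated_config n V' K' \<and> card V' = card V - j \<and> card K' = card K + j"
  using assms(2)
proof (induction j)
  case 0
  thus ?case using assms(1) by auto
next
  case (Suc j)
  then obtain V' K' where c: "separated_config n V' K'" "card V' = card V - j" "card K' = card K + j" by auto
  hence "V' \<noteq> {}" using Suc.prems by auto
  then obtain v where v: "v \<in> V'" by blast
  have "card (V' - {v}) = card V - Suc j" "card (insert v K') = card K + Suc j"
    using v c configD[OF c(1)] by (auto simp: card_Diff_singleton card_insert_if)
  thus ?case using config_move_to_core[OF c(1) v] by blast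
qed

text \<open>Coordinate 0 holds a height over the cube point with support \<open>Y\<close> and sign \<open>s\<close>.\<close>
definition cube_point :: "int \<Rightarrow> int \<Rightarrow> nat set \<Rightarrow> nat \<Rightarrow> int" where
  "cube_point s t Y = (\<lambda>i. if i = 0 then t else if i \<in> Y then s else 0)"

lemma cube_point_axis: "cube_point s t {} = cube_point s' t {}"
  by (auto simp: cube_point_def fun_eq_iff)

text \<open>For \<open>k = 2\<close> the core consists of the origin and the first unit vector. In the coordinates
  other than the first, the vertices run over the nonzero points of the unit cube and of its
  negative, each taken at heights 0 and 1 of the first coordinate; two more points on the first axis
  extend the core segment by one step at either end. For \<open>n = 2\<close> this is a hexagon.\<close>
definition prism_vertices :: "nat \<Rightarrow> (nat \<Rightarrow> int) set" where
  "prism_vertices n = {cube_point 1 (-1) {}, cube_point 1 2 {}} \<union>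
    (\<lambda>(s, t, Y). cube_point s t Y) ` ({1, -1} \<times> {0, 1} \<times> (Pow {1..<n} - {{}}))"

definition prism_core :: "(nat \<Rightarrow> int) set" where
  "prism_core = {cube_point 1 0 {}, cube_point 1 1 {}}"

lemma card_prism_vertices:
  assumes "2 \<le> n"
  shows "card (prism_vertices n) = 2 ^ (n + 1) - 2"
proof -
  let ?T = "{1, -1} \<times> {0, 1} \<times> (Pow {1..<n} - {{}}) :: (int \<times> int \<times> nat set) set"
  let ?f = "\<lambda>(s, t, Y). cube_point s t Y"
  have "inj_on ?f ?T"
  proof (rule inj_onI)
    fix x y assume xy: "x \<in> ?T" "y \<in> ?T" "?f x = ?f y"
    obtain s t Y s' t' Y' where [simp]: "x = (s, t, Y)" "y = (s', t', Y')" by (metis prod_cases3)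
    have eq: "cube_point s t Y i = cube_point s' t' Y' i" for i using xy(3) by simp
    have s: "s \<noteq> 0" "s' \<noteq> 0" and Y: "0 \<notin> Y" "0 \<notin> Y'" "Y \<noteq> {}" using xy(1,2) by auto
    have "t = t'" using eq[of 0] by (simp add: cube_point_def)
    moreover have "Y = Y'"
    proof (rule Set.set_eqI)
      fix i show "i \<in> Y \<longleftrightarrow> i \<in> Y'"
        using eq[of i] s Y by (cases "i = 0") (auto simp: cube_point_def split: if_splits)
    qed
    moreover obtain i where "i \<in> Y" using Y by blast
    ultimately have "s = s'" using eq[of i] Y by (auto simp: cube_point_def split: if_splits)
    thus "x = y" using \<open>t = t'\<close> \<open>Y = Y'\<close> by simp
  qed
  moreover have "card ?T = 4 * (2 ^ (n - 1) - 1)"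
    by (simp add: card_cartesian_product card_Diff_subset card_Pow)
  ultimately have cT: "card (?f ` ?T) = 4 * (2 ^ (n - 1) - 1)" by (simp add: card_image)
  have "cube_point 1 (-1) {} 0 \<noteq> cube_point 1 2 {} 0" by (simp add: cube_point_def)
  hence two: "card {cube_point 1 (-1) {}, cube_point 1 2 {}} = 2" by (metis card_2_iff)
  have "x 0 \<in> {0, 1}" if "x \<in> ?f ` ?T" for x using that by (auto simp: cube_point_def)
  moreover have "x 0 \<notin> {0, 1}" if "x \<in> {cube_point 1 (-1) {}, cube_point 1 2 {}}" for x
    using that by (auto simp: cube_point_def)
  ultimately have "{cube_point 1 (-1) {}, cube_point 1 2 {}} \<inter> ?f ` ?T = {}" by blast
  hence "card (prism_vertices n) =
      card {cube_point 1 (-1) {}, cube_point 1 2 {}} + card (?f ` ?T)"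
    unfolding prism_vertices_def by (intro card_Un_disjoint) auto
  hence "card (prism_vertices n) = 2 + 4 * (2 ^ (n - 1) - 1)" unfolding two cT .
  moreover obtain m where "n = Suc m" using assms by (cases n) auto
  moreover have "2 + 4 * ((2::nat) ^ m - 1) = 2 ^ (m + 2) - 2"
  proof -
    have "(2::nat) ^ (m + 2) = 4 * 2 ^ m" "(1::nat) \<le> 2 ^ m" by simp_all
    thus ?thesis by linarith
  qed
  ultimately show ?thesis by simp
qed

lemma prism_verticesE:
  assumes "x \<in> prism_vertices n"
  obtains "x = cube_point 1 (-1) {}" | "x = cube_point 1 2 {}"
    | s t Y where "x = cube_point s t Y" "s = 1 \<or> s = -1" "t = 0 \<or> t = 1" "Y \<subseteq> {1..<n}" "Y \<noteq> {}"
proof -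
  consider "x = cube_point 1 (-1) {}" | "x = cube_point 1 2 {}"
    | "x \<in> (\<lambda>(s, t, Y). cube_point s t Y) ` ({1, -1} \<times> {0, 1} \<times> (Pow {1..<n} - {{}}))"
    using assms unfolding prism_vertices_def by blast
  thus thesis
  proof cases
    case 3
    then obtain s t Y where "(s, t, Y) \<in> {1, -1} \<times> {0, 1} \<times> (Pow {1..<n} - {{}})" "x = cube_point s t Y"
      by auto
    thus thesis using that(3)[of s t Y] by simp
  qed (rule that(1) that(2), assumption)+
qed

lemma prism_cases:
  assumes "q \<in> prism_vertices n \<union> prism_core"
  obtains (point) s t Y where "q = cube_point s t Y" "s = 1 \<or> s = -1" "Y \<subseteq> {1..<n}" "-1 \<le> t" "t \<le> 2"
    "Y \<noteq> {} \<Longrightarrow> 0 \<le> t \<and> t \<le> 1"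
proof -
  have axis: thesis if q: "q = cube_point 1 t {}" "-1 \<le> t" "t \<le> 2" for t
    by (rule point[of 1 t "{}"]) (use q in auto)
  consider "q \<in> prism_vertices n" | "q = cube_point 1 0 {}" | "q = cube_point 1 1 {}"
    using assms unfolding prism_core_def by blast
  thus thesis
  proof cases
    case 1
    thus thesis
    proof (cases rule: prism_verticesE)
      case (3 s t Y)
      thus thesis by (intro point[of s t Y]) auto
    qed (use axis[of "-1"] axis[of 2] in auto)
  qed (use axis[of 0] axis[of 1] in auto)
qed

text \<open>On the cube \<open>s {0, 1}\<close> of the coordinates other than the first, this functional is
  maximal exactly at \<open>Y\<close>: a missing element of \<open>Y\<close> costs \<open>n\<close>, a superfluous one
  costs 1. The weight \<open>n\<close> also beats the opposite cube, where at most \<open>n - 1\<close> can be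
  collected from outside \<open>Y\<close>. The coefficient \<open>\<sigma>\<close> on the first axis then only decides between
  the heights.\<close>
definition cube_functional :: "nat \<Rightarrow> real \<Rightarrow> int \<Rightarrow> nat set \<Rightarrow> nat \<Rightarrow> real" where
  "cube_functional n \<sigma> s Y = (\<lambda>i. if i = 0 then \<sigma> else if i \<in> Y then s * real n else - s)"

lemma lin_cube_point:
  assumes "1 \<le> n" "Y' \<subseteq> {1..<n}"
  shows "lin n (cube_functional n \<sigma> s Y) (cube_point s' t' Y')
    = \<sigma> * t' + s * s' * (real n * card (Y' \<inter> Y) - card (Y' - Y))"
proof -
  let ?a = "cube_functional n \<sigma> s Y"
  have fin: "finite Y'" using assms(2) finite_subset by blast
  have "lin n ?a (cube_point s' t' Y') = \<sigma> * t' + (\<Sum>i\<in>{1..<n}. if i \<in> Y' then ?a i * s' else 0)"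
  proof -
    have "{..<n} = insert 0 {1..<n}" using assms(1) by auto
    hence "lin n ?a (cube_point s' t' Y') = \<sigma> * t' + (\<Sum>i\<in>{1..<n}. ?a i * cube_point s' t' Y' i)"
      unfolding lin_def by (simp add: cube_point_def cube_functional_def)
    also have "(\<Sum>i\<in>{1..<n}. ?a i * cube_point s' t' Y' i) =
        (\<Sum>i\<in>{1..<n}. if i \<in> Y' then ?a i * s' else 0)"
      by (intro sum.cong) (auto simp: cube_point_def)
    finally show ?thesis .
  qed
  also have "(\<Sum>i\<in>{1..<n}. if i \<in> Y' then ?a i * s' else 0) = (\<Sum>i\<in>Y'. ?a i * s')"
    using assms(2) by (subst sum.inter_restrict[symmetric]) (auto simp: Int_absorb1)
  also have "\<dots> = (\<Sum>i\<in>Y'. if i \<in> Y then s * s' * real n else - (s * s'))"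
    using assms(2) by (intro sum.cong) (auto simp: cube_functional_def)
  also have "\<dots> = s * s' * (real n * card (Y' \<inter> Y) - card (Y' - Y))"
    using fin by (simp add: sum.If_cases Diff_eq[symmetric] algebra_simps)
  finally show ?thesis by simp
qed

text \<open>The height \<open>t\<close> is arbitrary here, so this separates both the vertices and the integer points
  above and below them. The sign on the first axis pushes away from the heights 0 and 1, so no
  vertex above \<open>Y' \<noteq> {}\<close> gains more than \<open>cube_point s t Y\<close> from it; points of the first
  axis gain at most 1 more, which the weight of \<open>Y\<close> compensates.\<close>
lemma separate_cube_point:
  assumes n: "2 \<le> n" and s: "s = 1 \<or> s = -1" and Y: "Y \<subseteq> {1..<n}" "Y \<noteq> {}"
    and q: "q \<in> prism_vertices n \<union> prism_core" "q \<noteq> cube_point s t Y"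
  shows "lin n (cube_functional n (if 1 \<le> t then 1 else -1) s Y) q
    < lin n (cube_functional n (if 1 \<le> t then 1 else -1) s Y) (cube_point s t Y)"
    (is "lin n ?a q < _")
proof -
  define \<sigma> :: real where "\<sigma> = (if 1 \<le> t then 1 else -1)"
  obtain s' t' Y' where q': "q = cube_point s' t' Y'" "s' = 1 \<or> s' = -1" "Y' \<subseteq> {1..<n}"
    "-1 \<le> t'" "t' \<le> 2" "Y' \<noteq> {} \<Longrightarrow> 0 \<le> t' \<and> t' \<le> 1" using prism_cases[OF q(1)] by metis
  have fin: "finite Y" "finite Y'" using Y q'(3) finite_subset by blast+
  have ss: "real_of_int s * real_of_int s = 1" using s by auto
  have cY: "1 \<le> card Y" using fin Y(2) by (simp add: Suc_le_eq card_gt_0_iff)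
  have big: "real n \<le> real n * card Y"
    using cY mult_left_mono[of 1 "real (card Y)" "real n"] by simp
  have p_val: "lin n ?a (cube_point s t Y) = \<sigma> * t + real n * card Y"
    unfolding \<sigma>_def[symmetric] using lin_cube_point[of n Y \<sigma> s Y s t] n Y(1) by (simp add: ss)
  have q_val: "lin n ?a q = \<sigma> * t' + s * s' * (real n * card (Y' \<inter> Y) - card (Y' - Y))"
    unfolding \<sigma>_def[symmetric] using lin_cube_point[of n Y' \<sigma> s Y s' t'] n q'(1,3) by simp
  show ?thesis
  proof (cases "Y' = {}")
    case True
    have "\<sigma> * t' < \<sigma> * t + 2" using q'(4,5) by (auto simp: \<sigma>_def)
    moreover have "2 \<le> real n * card Y" using n big by linarith
    ultimately show ?thesis unfolding p_val q_val True by simp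
  next
    case False
    hence t': "0 \<le> t'" "t' \<le> 1" using q'(6) by auto
    hence le: "\<sigma> * t' \<le> \<sigma> * t" by (auto simp: \<sigma>_def)
    show ?thesis
    proof (cases "s' = s")
      case True
      have val: "lin n ?a q = \<sigma> * t' + (real n * card (Y' \<inter> Y) - card (Y' - Y))"
        unfolding q_val True by (simp add: ss)
      consider (eq) "Y' = Y" | (psub) "Y' \<subset> Y" | (out) "\<not> Y' \<subseteq> Y" by blast
      thus ?thesis
      proof cases
        case eq
        hence "t' \<noteq> t" using q(2) q'(1) True by auto
        hence "\<sigma> * t' < \<sigma> * t" using t' by (auto simp: \<sigma>_def)
        thus ?thesis unfolding val p_val eq by simp
      next
        case psub
        hence "card (Y' \<inter> Y) < card Y" using fin by (intro psubset_card_mono) auto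
        hence "real n * card (Y' \<inter> Y) < real n * card Y" using n by simp
        thus ?thesis using le unfolding val p_val by linarith
      next
        case out
        hence "card (Y' - Y) \<ge> 1" using fin by (simp add: Suc_le_eq card_gt_0_iff)
        moreover have "real n * card (Y' \<inter> Y) \<le> real n * card Y"
          using fin by (intro mult_left_mono) (auto intro: card_mono)
        ultimately show ?thesis using le unfolding val p_val by linarith
      qed
    next
      case False
      hence "s * s' = -1" using s q'(2) by auto
      hence "real_of_int s * real_of_int s' = -1" by (metis of_int_minus of_int_1 of_int_mult)
      hence val: "lin n ?a q = \<sigma> * t' - real n * card (Y' \<inter> Y) + card (Y' - Y)"
        unfolding q_val by simp
      have "card (Y' - Y) \<le> card {1..<n}" using q'(3) by (intro card_mono) auto
      hence "real (card (Y' - Y)) < real n" using n by simp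
      moreover have "0 \<le> real n * card (Y' \<inter> Y)" by simp
      ultimately show ?thesis using le big unfolding val p_val by linarith
    qed
  qed
qed

text \<open>An integer point with an entry beyond 1 in absolute value, or with entries of both signs,
  after the first coordinate is separated by a functional in one or two coordinates. All others lie
  above a point of one of the two cubes, or on the first axis.\<close>
lemma config_prism:
  assumes n: "2 \<le> n"
  shows "separated_config n (prism_vertices n) prism_core"
  unfolding separated_config_def
proof (intro conjI ballI)
  show "prism_vertices n \<inter> prism_core = {}"
  proof -
    have "x 0 \<notin> {0, 1} \<or> (\<exists>i. i \<noteq> 0 \<and> x i \<noteq> 0)" if x: "x \<in> prism_vertices n" for x
    proof -
      from x show ?thesis
      proof (cases rule: prism_verticesE)
        case (3 s t Y)
        then obtain i where "i \<in> Y" by blast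
        hence "i \<noteq> 0 \<and> x i \<noteq> 0" using 3 by (auto simp: cube_point_def)
        thus ?thesis by blast
      qed (auto simp: cube_point_def)
    qed
    moreover have "x 0 \<in> {0, 1} \<and> (\<forall>i. i \<noteq> 0 \<longrightarrow> x i = 0)" if "x \<in> prism_core" for x
      using that by (auto simp: prism_core_def cube_point_def)
    ultimately show ?thesis by blast
  qed
  have in_lattice: "q \<in> int_lattice n" if "q \<in> prism_vertices n \<union> prism_core" for q
    using that
  proof (cases rule: prism_cases)
    case (point s t Y)
    hence "i \<notin> Y" if "n \<le> i" for i using that by auto
    thus ?thesis using point(1) n by (auto simp: int_lattice_def cube_point_def)
  qed
  thus "prism_vertices n \<subseteq> int_lattice n" "prism_core \<subseteq> int_lattice n" by auto
  fix p assume p: "p \<in> int_lattice n - prism_core"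
  let ?W = "prism_vertices n \<union> prism_core"
  have entry: "\<bar>q i\<bar> \<le> 1 \<and> q i - q j \<le> 1" if "q \<in> ?W" "1 \<le> i" "1 \<le> j" for q i j
    using that(1)
  proof (cases rule: prism_cases)
    case (point s t Y)
    thus ?thesis using that(2,3) by (auto simp: cube_point_def)
  qed
  consider (large) i where "1 \<le> i" "i < n" "2 \<le> \<bar>p i\<bar>"
    | (mixed) i j where "1 \<le> i" "i < n" "1 \<le> j" "j < n" "p i = 1" "p j = -1"
    | (cube) s where "s = 1 \<or> s = -1" "\<And>i. 1 \<le> i \<Longrightarrow> i < n \<Longrightarrow> p i = 0 \<or> p i = s"
  proof -
    have "(\<exists>i. 1 \<le> i \<and> i < n \<and> 2 \<le> \<bar>p i\<bar>) \<or> (\<forall>i. 1 \<le> i \<and> i < n \<longrightarrow> p i = 0 \<or> p i = 1 \<or> p i = -1)"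
      by (smt (verit))
    thus thesis using large mixed cube[of 1] cube[of "-1"] by blast
  qed
  thus "\<exists>a. \<forall>q\<in>?W - {p}. lin n a q < lin n a p"
  proof cases
    case large
    have "lin n (coord i (sgn (p i))) q < lin n (coord i (sgn (p i))) p" if "q \<in> ?W" for q
      using entry[OF that large(1,1)] large(2,3) by (auto simp: lin_coord sgn_if)
    thus ?thesis by blast
  next
    case mixed
    let ?a = "\<lambda>l. coord i 1 l + coord j (-1) l"
    have "lin n ?a q < lin n ?a p" if "q \<in> ?W" for q
      using entry[OF that mixed(1,3)] mixed unfolding lin_add_left by (simp add: lin_coord)
    thus ?thesis by blast
  next
    case cube
    define Y where "Y = {i. 1 \<le> i \<and> i < n \<and> p i \<noteq> 0}"
    have Y: "Y \<subseteq> {1..<n}" by (auto simp: Y_def)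
    have p_eq: "p = cube_point s (p 0) Y"
    proof
      fix i show "p i = cube_point s (p 0) Y i"
        using cube(2)[of i] p by (cases "i < n") (auto simp: cube_point_def Y_def int_lattice_def)
    qed
    show ?thesis
    proof (cases "Y = {}")
      case False
      show ?thesis
        using separate_cube_point[OF n cube(1) Y False, of _ "p 0"] p_eq by (metis DiffE singletonI)
    next
      case True
      have p1: "p = cube_point 1 (p 0) {}" 
        using cube_point_axis[of s "p 0" 1] p_eq True by simp
      define \<sigma> :: real where "\<sigma> = (if 1 \<le> p 0 then 1 else -1)"
      have p01: "p 0 \<noteq> 0" "p 0 \<noteq> 1" using p p1 by (auto simp: prism_core_def)
      have "lin n (coord 0 \<sigma>) q < lin n (coord 0 \<sigma>) p" if q: "q \<in> ?W" "q \<noteq> p" for q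
      proof -
        have "0 \<le> q 0 \<and> q 0 \<le> 1 \<or> q = cube_point 1 (-1) {} \<or> q = cube_point 1 2 {}"
          using q(1) by (auto simp: prism_core_def cube_point_def elim!: prism_verticesE)
        moreover have "p 0 \<noteq> -1" if "q = cube_point 1 (-1) {}" using that q(2) p1 by auto
        moreover have "p 0 \<noteq> 2" if "q = cube_point 1 2 {}" using that q(2) p1 by auto
        moreover have "0 < n" using n by simp
        ultimately show ?thesis using p01
          by (auto simp: lin_coord \<sigma>_def cube_point_def)
      qed
      thus ?thesis by blast
    qed
  qed
qed (auto simp: prism_vertices_def prism_core_def)

text \<open>Moving \<open>k - 2\<close> vertices of the prism to its core leaves
  \<open>2 ^ (n + 1) - k\<close> of them.\<close>
lemma doignon_number_lower:
  assumes "2 \<le> k" "k \<le> n"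
  shows "2 ^ (n + 1) \<le> doignon_number n k + k"
proof -
  have "2 \<le> n" using assms by simp
  have "cube_point 1 0 {} 0 \<noteq> cube_point 1 1 {} 0" by (simp add: cube_point_def)
  hence core: "card prism_core = 2" unfolding prism_core_def by (metis card_2_iff)
  have "k < 2 ^ n" using assms(2) less_exp[of n] by linarith
  hence "k - 2 \<le> card (prism_vertices n)" unfolding card_prism_vertices[OF \<open>2 \<le> n\<close>] by simp
  then obtain V K where "separated_config n V K" "card V = 2 ^ (n + 1) - 2 - (k - 2)" "card K = 2 + (k - 2)"
    using config_shrink[OF config_prism[OF \<open>2 \<le> n\<close>]] card_prism_vertices[OF \<open>2 \<le> n\<close>] core by metis
  moreover from this have "card K = k" using assms(1) by simp
  ultimately have "2 ^ (n + 1) - 2 - (k - 2) \<le> doignon_number n k"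
    using card_config_le_doignon_number[of n V K] by simp
  thus ?thesis using assms(1) by linarith
qed

theorem corollary3p13:
  fixes n k :: nat
  assumes "2 \<le> k" and "k \<le> n"
  shows "2 ^ (n + 1) - int k \<le> int (doignon_number n k) \<and>
         int (doignon_number n k) \<le> int (doignon_number (k - 1) k) + 2 * (2 ^ n - 2)"
proof -
  have "int (2 ^ (n + 1)) \<le> int (doignon_number n k + k)"
    using doignon_number_lower[OF assms] by (rule of_nat_mono)
  moreover have "int (doignon_number n k) \<le> int (doignon_number (k - 1) k + 2 * (2 ^ n - 2))"
    using doignon_number_upper[OF assms] by (rule of_nat_mono)
  moreover have "(2::nat) \<le> 2 ^ n" using assms self_le_power[of 2 n] by simp
  ultimately show ?thesis by (simp add: of_nat_diff)
qed

end
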